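(* Let $g\in\{3,4,5\}$ and let $C_g$ be the bare cycle on vertices $0,\dots,g-1$ with edges $c_j=\{j,j+1\}$ of weight $w_j>0$ (indices mod $g$). Suppose the edge $c_j$ and the arc from $j-1$ to $j+2$ avoiding $c_j$ (the path $j+2,j+3,\dots,j-1$ with $g-3$ edges, of length $0$ if $g=3$) are geodesics between their endpoints (this holds for all $j$ on a neighbourhood of the uniform weighting). Then $$\kappa_{c_j}=\frac12\Big(3-\frac{d(j-1,\,j+2)}{w_j}\Big),$$ where $d(j-1,j+2)$ is the length of that avoiding arc. Explicitly, $$C_3:\ \kappa_{c_j}\equiv\tfrac32;\qquad C_4:\ \kappa_{c_j}=\tfrac12\Big(3-\tfrac{w_{j+2}}{w_j}\Big);\qquad C_5:\ \kappa_{c_j}=\tfrac12\Big(3-\tfrac{w_{j+2}+w_{j+3}}{w_j}\Big).$$ In particular $\kappa_{c_j}w_j=\tfrac12\big(3w_j-d(j-1,j+2)\big)$ is linear in $w$, so in the regime where the hypothesis holds for every $j$ one has $\kappa_{c_j}w_j=-(Rw)_j$ for the symmetric matrix $$C_3:\ R=-\tfrac32I;\qquad C_4:\ R=-\tfrac32I+\tfrac12P_{\mathrm{opp}};\qquad C_5:\ R=-\tfrac32I+\tfrac12P_2,$$ where $(P_{\mathrm{opp}})_{jk}=1$ iff $k\equiv j+2\pmod 4$ and $(P_2)_{jk}=1$ iff $k\equiv j\pm2\pmod5$, all other entries being $0$. The uniform weighting is a discrete Einstein metric with curvature $\kappa=\tfrac32,\,1,\,\tfrac12$ for $g=3,4,5$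 respectively.
   Context: Weighted graphs: $G=(V,E)$ is a finite connected simple graph, $w:E\to\mathbb{R}_{>0}$ an edge weighting, $d_v$ the combinatorial degree, and $d(x,y)$ the least total weight of a path from $x$ to $y$. A path is a geodesic if its total weight equals the distance between its endpoints. Lin--Lu--Yau curvature: for $\alpha\in[0,1]$ let $\mu_x^\alpha$ be the probability measure with mass $\alpha$ at $x$ and $(1-\alpha)/d_x$ at each neighbour of $x$. Let $W$ be the $L^1$-Wasserstein distance with respect to $d$. For an edge $x\sim y$ put $\kappa_\alpha(x,y)=1-W(\mu_x^\alpha,\mu_y^\alpha)/d(x,y)$ and $\kappa_{xy}=\lim_{\alpha\to1}\kappa_\alpha(x,y)/(1-\alpha)$. A positive weighting $w$ is a discrete Einstein metric of curvature $\kappa$ if $\kappa_e=\kappa$ for every edge $e$. *)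

theory Defs
  imports
    "HOL-Probability.Probability_Mass_Function"
    "HOL-Number_Theory.Cong"
    "Jordan_Normal_Form.Matrix"
begin

section \<open>Weighted graphs\<close>

text \<open>A graph is given by a vertex set \<open>V\<close> and a set \<open>E\<close> of two-element subsets of \<open>V\<close>;
  an edge weighting is a function on edges, of which only the values on \<open>E\<close> are ever used.\<close>

definition adj :: "'a set set \<Rightarrow> 'a \<Rightarrow> 'a \<Rightarrow> bool" where
  "adj E x y \<longleftrightarrow> {x, y} \<in> E"

definition is_path :: "'a set \<Rightarrow> 'a set set \<Rightarrow> 'a list \<Rightarrow> bool" where
  "is_path V E p \<longleftrightarrow> p \<noteq> [] \<and> set p \<subseteq> V \<and> distinct p \<and> successively (adj E) p"

definition finite_connected_simple_graph :: "'a set \<Rightarrow> 'a set set \<Rightarrow> bool" where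
  "finite_connected_simple_graph V E \<longleftrightarrow>
     finite V \<and> V \<noteq> {} \<and>
     (\<forall>e\<in>E. \<exists>x\<in>V. \<exists>y\<in>V. x \<noteq> y \<and> e = {x, y}) \<and>
     (\<forall>x\<in>V. \<forall>y\<in>V. \<exists>p. is_path V E p \<and> hd p = x \<and> last p = y)"

definition positive_weighting :: "'a set set \<Rightarrow> ('a set \<Rightarrow> real) \<Rightarrow> bool" where
  "positive_weighting E w \<longleftrightarrow> (\<forall>e\<in>E. 0 < w e)"

definition path_weight :: "('a set \<Rightarrow> real) \<Rightarrow> 'a list \<Rightarrow> real" where
  "path_weight w p = (\<Sum>i<length p - 1. w {p ! i, p ! Suc i})"

text \<open>In a finite connected graph the set below is finite and nonempty, so \<^const>\<open>Min\<close> is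
  meaningful.\<close>

definition gdist :: "'a set \<Rightarrow> 'a set set \<Rightarrow> ('a set \<Rightarrow> real) \<Rightarrow> 'a \<Rightarrow> 'a \<Rightarrow> real" where
  "gdist V E w x y = Min {path_weight w p | p. is_path V E p \<and> hd p = x \<and> last p = y}"

definition is_geodesic :: "'a set \<Rightarrow> 'a set set \<Rightarrow> ('a set \<Rightarrow> real) \<Rightarrow> 'a list \<Rightarrow> bool" where
  "is_geodesic V E w p \<longleftrightarrow> is_path V E p \<and> path_weight w p = gdist V E w (hd p) (last p)"

section \<open>Lin--Lu--Yau curvature\<close>

definition deg :: "'a set set \<Rightarrow> 'a \<Rightarrow> nat" where
  "deg E x = card {y. adj E x y}"

text \<open>\<^const>\<open>embed_pmf\<close> turns a mass function into a probability measure; it is only meaningful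
  when the masses are nonnegative with sum 1, see \<open>pmf_lazy_walk\<close>.\<close>

definition lazy_walk :: "'a set set \<Rightarrow> real \<Rightarrow> 'a \<Rightarrow> 'a pmf" where
  "lazy_walk E \<alpha> x =
     embed_pmf (\<lambda>v. if v = x then \<alpha> else if adj E x v then (1 - \<alpha>) / real (deg E x) else 0)"

definition wasserstein :: "('a \<Rightarrow> 'a \<Rightarrow> real) \<Rightarrow> 'a pmf \<Rightarrow> 'a pmf \<Rightarrow> real" where
  "wasserstein d \<mu> \<nu> =
     Inf {measure_pmf.expectation \<pi> (\<lambda>(u, v). d u v) | \<pi>. map_pmf fst \<pi> = \<mu> \<and> map_pmf snd \<pi> = \<nu>}"

definition kappa_alpha ::
    "'a set \<Rightarrow> 'a set set \<Rightarrow> ('a set \<Rightarrow> real) \<Rightarrow> real \<Rightarrow> 'a \<Rightarrow> 'a \<Rightarrow> real" where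
  "kappa_alpha V E w \<alpha> x y =
     1 - wasserstein (gdist V E w) (lazy_walk E \<alpha> x) (lazy_walk E \<alpha> y) / gdist V E w x y"

definition LLY_curvature :: "'a set \<Rightarrow> 'a set set \<Rightarrow> ('a set \<Rightarrow> real) \<Rightarrow> 'a \<Rightarrow> 'a \<Rightarrow> real" where
  "LLY_curvature V E w x y =
     Lim (at 1 within {0..1}) (\<lambda>\<alpha>. kappa_alpha V E w \<alpha> x y / (1 - \<alpha>))"

definition discrete_Einstein_metric ::
    "'a set \<Rightarrow> 'a set set \<Rightarrow> ('a set \<Rightarrow> real) \<Rightarrow> real \<Rightarrow> bool" where
  "discrete_Einstein_metric V E w \<kappa> \<longleftrightarrow>
     positive_weighting E w \<and> (\<forall>x y. {x, y} \<in> E \<longrightarrow> LLY_curvature V E w x y = \<kappa>)"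

lemma pmf_lazy_walk:
  assumes "finite {y. adj E x y}" "{y. adj E x y} \<noteq> {}" "\<not> adj E x x" "0 \<le> \<alpha>" "\<alpha> \<le> 1"
  shows "pmf (lazy_walk E \<alpha> x) v =
    (if v = x then \<alpha> else if adj E x v then (1 - \<alpha>) / real (deg E x) else 0)"
proof -
  let ?N = "{y. adj E x y}"
  let ?f = "\<lambda>v. if v = x then \<alpha> else if adj E x v then (1 - \<alpha>) / real (deg E x) else 0"
  have d: "real (deg E x) > 0"
    using assms(1,2) by (simp add: deg_def card_gt_0_iff)
  have nonneg: "0 \<le> ?f v" for v
    using assms(4,5) by simp
  have x: "x \<notin> ?N" using assms(3) by simp
  have "(\<integral>\<^sup>+ v. ennreal (?f v) \<partial>count_space UNIV) = (\<Sum>v\<in>insert x ?N. ennreal (?f v))"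
    by (rule nn_integral_count_space') (use assms(1) in auto)
  also have "\<dots> = ennreal (\<Sum>v\<in>insert x ?N. ?f v)"
    by (rule sum_ennreal) (rule nonneg)
  also have "(\<Sum>v\<in>insert x ?N. ?f v) = \<alpha> + (\<Sum>v\<in>?N. ?f v)"
    using assms(1) x by simp
  also have "(\<Sum>v\<in>?N. ?f v) = (\<Sum>v\<in>?N. (1 - \<alpha>) / real (deg E x))"
    by (rule sum.cong) (use x in auto)
  also have "\<dots> = 1 - \<alpha>"
    using d by (simp add: deg_def)
  finally have "(\<integral>\<^sup>+ v. ennreal (?f v) \<partial>count_space UNIV) = 1" by simp
  then show ?thesis
    unfolding lazy_walk_def by (rule pmf_embed_pmf[OF nonneg])
qed

section \<open>The cycle\<close>

definition cyc_V :: "nat \<Rightarrow> nat set" where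
  "cyc_V g = {..<g}"

definition cyc_edge :: "nat \<Rightarrow> nat \<Rightarrow> nat set" where
  "cyc_edge g j = {j mod g, (j + 1) mod g}"

definition cyc_E :: "nat \<Rightarrow> nat set set" where
  "cyc_E g = cyc_edge g ` {..<g}"

definition cyc_wt :: "nat \<Rightarrow> (nat set \<Rightarrow> real) \<Rightarrow> nat \<Rightarrow> real" where
  "cyc_wt g w j = w (cyc_edge g j)"

text \<open>The path \<open>j+2, j+3, \<dots>, j-1\<close> (indices mod \<open>g\<close>); it has \<open>g - 2\<close> vertices, hence
  \<open>g - 3\<close> edges.\<close>

definition avoiding_arc :: "nat \<Rightarrow> nat \<Rightarrow> nat list" where
  "avoiding_arc g j = map (\<lambda>i. (j + 2 + i) mod g) [0..<g - 2]"

definition cyc_dist :: "nat \<Rightarrow> (nat set \<Rightarrow> real) \<Rightarrow> nat \<Rightarrow> nat \<Rightarrow> real" where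
  "cyc_dist g w x y = gdist (cyc_V g) (cyc_E g) w (x mod g) (y mod g)"

definition cyc_curv :: "nat \<Rightarrow> (nat set \<Rightarrow> real) \<Rightarrow> nat \<Rightarrow> real" where
  "cyc_curv g w j = LLY_curvature (cyc_V g) (cyc_E g) w (j mod g) ((j + 1) mod g)"

definition geodesic_at :: "nat \<Rightarrow> (nat set \<Rightarrow> real) \<Rightarrow> nat \<Rightarrow> bool" where
  "geodesic_at g w j \<longleftrightarrow>
     is_geodesic (cyc_V g) (cyc_E g) w [j mod g, (j + 1) mod g] \<and>
     is_geodesic (cyc_V g) (cyc_E g) w (avoiding_arc g j)"

definition weight_vec :: "nat \<Rightarrow> (nat set \<Rightarrow> real) \<Rightarrow> real vec" where
  "weight_vec g w = vec g (cyc_wt g w)"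

definition P_opp :: "real mat" where
  "P_opp = mat 4 4 (\<lambda>(j, k). if [k = j + 2] (mod 4) then 1 else 0)"

definition P_2 :: "real mat" where
  "P_2 = mat 5 5 (\<lambda>(j, k).
     if [int k = int j + 2] (mod 5) \<or> [int k = int j - 2] (mod 5) then 1 else 0)"

definition cyc_R :: "nat \<Rightarrow> real mat" where
  "cyc_R g =
     (if g = 3 then (- 3/2) \<cdot>\<^sub>m 1\<^sub>m 3
      else if g = 4 then (- 3/2) \<cdot>\<^sub>m 1\<^sub>m 4 + (1/2) \<cdot>\<^sub>m P_opp
      else (- 3/2) \<cdot>\<^sub>m 1\<^sub>m 5 + (1/2) \<cdot>\<^sub>m P_2)"

lemma cyc_graph:
  assumes "g \<ge> 3"
  shows "finite_connected_simple_graph (cyc_V g) (cyc_E g)"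
proof -
  have up: "is_path (cyc_V g) (cyc_E g) [x..<Suc y]" if "x \<le> y" "y < g" for x y
  proof -
    have "successively (adj (cyc_E g)) [x..<Suc y]"
      unfolding successively_conv_nth
    proof (intro allI impI)
      fix i assume i: "Suc i < length [x..<Suc y]"
      then have "{x + i, Suc (x + i)} = cyc_edge g (x + i)" "x + i < g"
        using that by (auto simp: cyc_edge_def)
      then have "adj (cyc_E g) (x + i) (Suc (x + i))"
        by (auto simp: adj_def cyc_E_def)
      with i show "adj (cyc_E g) ([x..<Suc y] ! i) ([x..<Suc y] ! Suc i)"
        by (simp del: upt_Suc)
    qed
    with that show ?thesis
      by (auto simp: is_path_def cyc_V_def simp del: upt_Suc)
  qed
  have down: "is_path (cyc_V g) (cyc_E g) (rev [x..<Suc y])" if "x \<le> y" "y < g" for x y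
  proof -
    have "(\<lambda>a b. adj (cyc_E g) b a) = adj (cyc_E g)"
      by (auto simp: adj_def insert_commute fun_eq_iff)
    then have "successively (\<lambda>a b. adj (cyc_E g) b a) p = successively (adj (cyc_E g)) p" for p
      by (rule arg_cong)
    with up[OF that] show ?thesis
      unfolding is_path_def successively_rev set_rev distinct_rev rev_is_Nil_conv by blast
  qed
  have conn: "\<exists>p. is_path (cyc_V g) (cyc_E g) p \<and> hd p = x \<and> last p = y"
    if "x < g" "y < g" for x y
  proof (cases "x \<le> y")
    case True
    then have "hd [x..<Suc y] = x" "last [x..<Suc y] = y" by (auto simp del: upt_Suc)
    with up[OF True that(2)] show ?thesis by blast
  next
    case False
    then have "hd (rev [y..<Suc x]) = x" "last (rev [y..<Suc x]) = y"
      by (auto simp: hd_rev last_rev simp del: upt_Suc)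
    with down[of y x] False that(1) show ?thesis by (metis nle_le)
  qed
  have edge: "\<exists>x\<in>cyc_V g. \<exists>y\<in>cyc_V g. x \<noteq> y \<and> e = {x, y}" if e: "e \<in> cyc_E g" for e
  proof -
    from e obtain j where j: "j < g" "e = {j, (j + 1) mod g}"
      by (auto simp: cyc_E_def cyc_edge_def)
    moreover have "j \<noteq> (j + 1) mod g"
      using assms j(1) by (cases "j + 1 = g") auto
    moreover have "(j + 1) mod g < g" using assms by simp
    ultimately show ?thesis unfolding cyc_V_def by blast
  qed
  show ?thesis
    using assms edge conn unfolding finite_connected_simple_graph_def
    by (auto simp: cyc_V_def lessThan_empty_iff)
qed

end

theory Submission
  imports Defs
begin

text \<open>Put \<open>D\<close> for the length of the avoiding arc. A function on the vertices that is 1-Lipschitz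
  along edges bounds all distances from below, and on the cycle there is one that drops by \<open>w\<^sub>j\<close>
  along \<open>c\<^sub>j\<close> and by \<open>D\<close> along the avoiding arc as soon as neither of these two lengths exceeds
  the sum of the other and of \<open>w\<^bsub>j-1\<^esub>\<close> and \<open>w\<^bsub>j+1\<^esub>\<close>. Hence these two inequalities characterise the
  geodesic hypothesis, which gives its stability near the uniform weighting, and the same function is
  a Kantorovich potential certifying that transporting \<open>(3 * \<alpha> - 1) / 2\<close> along \<open>c\<^sub>j\<close> and
  \<open>(1 - \<alpha>) / 2\<close> along the avoiding arc is optimal for \<open>\<alpha> \<ge> 1/3\<close>. So \<open>\<kappa>\<^sub>\<alpha> / (1 - \<alpha>)\<close> is constant on
  \<open>[1/3, 1)\<close>.\<close>

section \<open>Path weights, distances and functions that are 1-Lipschitz along edges\<close>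

lemma path_weight_Cons_Cons:
  "path_weight w (x # y # p) = w {x, y} + path_weight w (y # p)"
  by (simp add: path_weight_def sum.lessThan_Suc_shift del: sum.lessThan_Suc)

lemma path_weight_singleton: "path_weight w [x] = 0"
  by (simp add: path_weight_def)

lemma path_weight_rev: "path_weight w (rev p) = path_weight w p"
proof -
  have "path_weight w (rev p) = (\<Sum>i<length p - 1. w {p ! Suc (length p - 1 - Suc i), p ! (length p - 1 - Suc i)})"
    unfolding path_weight_def by (rule sum.cong) (auto simp: rev_nth Suc_diff_Suc)
  also have "\<dots> = (\<Sum>i<length p - 1. w {p ! Suc i, p ! i})"
    by (rule sum.nat_diff_reindex)
  finally show ?thesis
    by (simp add: path_weight_def insert_commute)
qed

lemma adj_commute: "adj E x y \<longleftrightarrow> adj E y x"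
  by (simp add: adj_def insert_commute)

lemma is_path_rev: "is_path V E (rev p) \<longleftrightarrow> is_path V E p"
proof -
  have "(\<lambda>a b. adj E b a) = adj E"
    by (intro ext) (rule adj_commute)
  then have "successively (\<lambda>a b. adj E b a) p = successively (adj E) p"
    by (rule arg_cong)
  then show ?thesis
    unfolding is_path_def successively_rev by simp
qed

text \<open>Reversing paths is a weight-preserving bijection between the two sets over which the
  minimum is taken.\<close>

lemma gdist_commute: "gdist V E w x y = gdist V E w y x"
proof -
  have "{path_weight w p | p. is_path V E p \<and> hd p = x \<and> last p = y}
      \<subseteq> {path_weight w p | p. is_path V E p \<and> hd p = y \<and> last p = x}" for x y
    by clarify (metis hd_rev last_rev is_path_rev path_weight_rev)
  then show ?thesis
    unfolding gdist_def by (intro arg_cong[where f = Min] equalityI)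
qed

text \<open>Paths repeat no vertex, so a finite vertex set carries only finitely many of them. This
  is what makes \<open>Min\<close> in \<open>gdist\<close> meaningful.\<close>

lemma finite_path_weights:
  assumes "finite V"
  shows "finite {path_weight w p | p. is_path V E p \<and> hd p = x \<and> last p = y}"
proof -
  have "{path_weight w p | p. is_path V E p \<and> hd p = x \<and> last p = y}
      \<subseteq> path_weight w ` {p. set p \<subseteq> V \<and> distinct p}"
    by (auto simp: is_path_def)
  with finite_subset_distinct[OF assms] show ?thesis
    by (blast intro: finite_subset)
qed

lemma gdist_le_path_weight:
  assumes "finite V" "is_path V E p"
  shows "gdist V E w (hd p) (last p) \<le> path_weight w p"
  unfolding gdist_def using assms finite_path_weights[OF assms(1)] by (intro Min_le) auto

text \<open>The feasible functions of the linear program dual to the shortest path problem.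
  Adjacency is symmetric, so the one-sided inequality bounds
  \<open>\<bar>f x - f y\<bar>\<close>.\<close>

definition edge_lipschitz :: "'a set set \<Rightarrow> ('a set \<Rightarrow> real) \<Rightarrow> ('a \<Rightarrow> real) \<Rightarrow> bool" where
  "edge_lipschitz E w f \<longleftrightarrow> (\<forall>x y. adj E x y \<longrightarrow> f x - f y \<le> w {x, y})"

lemma edge_lipschitz_path:
  assumes "edge_lipschitz E w f"
  shows "p \<noteq> [] \<Longrightarrow> successively (adj E) p \<Longrightarrow> f (hd p) - f (last p) \<le> path_weight w p"
proof (induction p rule: induct_list012)
  case (3 x y p)
  then have "f x - f y \<le> w {x, y}"
    using assms by (simp add: edge_lipschitz_def)
  with 3 show ?case by (simp add: path_weight_Cons_Cons)
qed (simp_all add: path_weight_singleton)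

text \<open>Telescoping along a path bounds its weight from below by \<open>f x - f y\<close>;
  connectedness ensures that the minimum is taken over a nonempty set.\<close>

lemma edge_lipschitz_gdist:
  assumes "finite_connected_simple_graph V E" "edge_lipschitz E w f" "x \<in> V" "y \<in> V"
  shows "f x - f y \<le> gdist V E w x y"
proof -
  let ?S = "{path_weight w p | p. is_path V E p \<and> hd p = x \<and> last p = y}"
  have "finite ?S"
    using assms(1) by (intro finite_path_weights) (simp add: finite_connected_simple_graph_def)
  moreover have "?S \<noteq> {}"
    using assms unfolding finite_connected_simple_graph_def by blast
  moreover have "\<forall>s\<in>?S. f x - f y \<le> s"
    using edge_lipschitz_path[OF assms(2)] by (auto simp: is_path_def)
  ultimately show ?thesis
    unfolding gdist_def by simp
qed

text \<open>Optimality certificate: no path can be lighter than the drop of \<open>f\<close> between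
  its ends, so a path whose weight is at most that drop is shortest.\<close>

lemma is_geodesic_edge_lipschitzI:
  assumes "finite_connected_simple_graph V E" "is_path V E p"
    "edge_lipschitz E w f" "path_weight w p \<le> f (hd p) - f (last p)"
  shows "is_geodesic V E w p"
proof -
  have "finite V" "hd p \<in> V" "last p \<in> V"
    using assms(1,2) hd_in_set[of p] last_in_set[of p]
    by (auto simp: finite_connected_simple_graph_def is_path_def simp del: hd_in_set last_in_set)
  then show ?thesis
    unfolding is_geodesic_def
    using assms edge_lipschitz_gdist[OF assms(1,3), of "hd p" "last p"]
      gdist_le_path_weight[of V E p w] by auto
qed

lemma gdist_self:
  assumes "finite_connected_simple_graph V E" "positive_weighting E w" "x \<in> V"
  shows "gdist V E w x x = 0"
proof -
  have "edge_lipschitz E w (\<lambda>_. 0)"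
    using assms(2) by (auto simp: edge_lipschitz_def adj_def positive_weighting_def intro: less_imp_le)
  moreover have "is_path V E [x]"
    using assms(3) by (simp add: is_path_def)
  ultimately have "is_geodesic V E w [x]"
    using assms(1) by (intro is_geodesic_edge_lipschitzI[where f = "\<lambda>_. 0"]) (simp_all add: path_weight_singleton)
  then show ?thesis
    by (simp add: is_geodesic_def path_weight_singleton)
qed

section \<open>Symmetry and duality for the Wasserstein distance\<close>

lemma wasserstein_commute:
  assumes "\<And>x y. d x y = d y x"
  shows "wasserstein d \<mu> \<nu> = wasserstein d \<nu> \<mu>"
proof -
  let ?C = "\<lambda>\<mu> \<nu>. {measure_pmf.expectation \<pi> (\<lambda>(u, v). d u v) | \<pi>. map_pmf fst \<pi> = \<mu> \<and> map_pmf snd \<pi> = \<nu>}"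
  have "?C \<mu> \<nu> \<subseteq> ?C \<nu> \<mu>" for \<mu> \<nu>
  proof clarify
    fix \<pi> :: "('a \<times> 'a) pmf"
    have "measure_pmf.expectation \<pi> (\<lambda>(u, v). d u v) =
        measure_pmf.expectation (map_pmf prod.swap \<pi>) (\<lambda>(u, v). d u v)"
      using assms by (simp add: case_prod_unfold)
    then show "\<exists>\<pi>'. measure_pmf.expectation \<pi> (\<lambda>(u, v). d u v) = measure_pmf.expectation \<pi>' (\<lambda>(u, v). d u v)
        \<and> map_pmf fst \<pi>' = map_pmf snd \<pi> \<and> map_pmf snd \<pi>' = map_pmf fst \<pi>"
      by (intro exI[of _ "map_pmf prod.swap \<pi>"]) (simp add: map_pmf_comp)
  qed
  then show ?thesis
    unfolding wasserstein_def by (intro arg_cong[where f = Inf] equalityI)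
qed

text \<open>The curvature is computed for an edge oriented from \<open>j\<close> to
  \<open>j + 1\<close>, while the Einstein condition speaks of both orientations.\<close>

lemma LLY_curvature_commute: "LLY_curvature V E w x y = LLY_curvature V E w y x"
  unfolding LLY_curvature_def kappa_alpha_def
  using wasserstein_commute[of "gdist V E w", OF gdist_commute] gdist_commute[of V E w x y] by simp

text \<open>Complementary slackness in Kantorovich duality: a coupling and a 1-Lipschitz potential that
  is tight on the support of the coupling are both optimal.\<close>

lemma wasserstein_eq_dual:
  assumes fin: "finite (set_pmf \<mu>)" "finite (set_pmf \<nu>)"
    and lip: "\<And>u v. u \<in> set_pmf \<mu> \<Longrightarrow> v \<in> set_pmf \<nu> \<Longrightarrow> f u - f v \<le> d u v"
    and \<pi>: "map_pmf fst \<pi> = \<mu>" "map_pmf snd \<pi> = \<nu>"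
    and tight: "\<And>u v. (u, v) \<in> set_pmf \<pi> \<Longrightarrow> d u v = f u - f v"
  shows "wasserstein d \<mu> \<nu> = measure_pmf.expectation \<mu> f - measure_pmf.expectation \<nu> f"
proof -
  let ?E = "\<lambda>\<pi>. measure_pmf.expectation \<pi> (\<lambda>(u, v). d u v)"
  let ?P = "\<lambda>\<pi>. map_pmf fst \<pi> = \<mu> \<and> map_pmf snd \<pi> = \<nu>"
  have sub: "set_pmf \<rho> \<subseteq> set_pmf \<mu> \<times> set_pmf \<nu>" if "?P \<rho>" for \<rho>
    using that by (force simp: subset_iff)
  have int: "integrable (measure_pmf \<rho>) h" if "?P \<rho>" for \<rho> and h :: "'a \<times> 'a \<Rightarrow> real"
    using finite_subset[OF sub[OF that]] fin by (intro integrable_measure_pmf_finite) simp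
  have dual: "measure_pmf.expectation \<rho> (\<lambda>(u, v). f u - f v)
      = measure_pmf.expectation \<mu> f - measure_pmf.expectation \<nu> f" if "?P \<rho>" for \<rho>
  proof -
    have "measure_pmf.expectation \<rho> (\<lambda>(u, v). f u - f v)
        = measure_pmf.expectation \<rho> (\<lambda>z. f (fst z)) - measure_pmf.expectation \<rho> (\<lambda>z. f (snd z))"
      by (simp add: case_prod_unfold int[OF that])
    also have "\<dots> = measure_pmf.expectation (map_pmf fst \<rho>) f - measure_pmf.expectation (map_pmf snd \<rho>) f"
      by simp
    finally show ?thesis using that by simp
  qed
  have lower: "measure_pmf.expectation \<mu> f - measure_pmf.expectation \<nu> f \<le> ?E \<rho>" if "?P \<rho>" for \<rho>
    unfolding dual[OF that, symmetric]
    using sub[OF that] lip by (intro integral_mono_AE int[OF that]) (auto simp: AE_measure_pmf_iff)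
  have "?E \<pi> = measure_pmf.expectation \<pi> (\<lambda>(u, v). f u - f v)"
    using tight by (intro integral_cong_AE) (auto simp: AE_measure_pmf_iff)
  also have "\<dots> = measure_pmf.expectation \<mu> f - measure_pmf.expectation \<nu> f"
    using \<pi> by (intro dual) simp
  finally have upper: "?E \<pi> = measure_pmf.expectation \<mu> f - measure_pmf.expectation \<nu> f" .
  show ?thesis
    unfolding wasserstein_def
  proof (rule cInf_eq_minimum)
    show "measure_pmf.expectation \<mu> f - measure_pmf.expectation \<nu> f \<in> {?E \<pi> |\<pi>. ?P \<pi>}"
      using \<pi> upper by (intro CollectI exI[of _ \<pi>]) simp
  qed (use lower in blast)
qed

section \<open>Distributions given by lists of weighted atoms\<close>

lemma map_pmf_of_list:
  assumes "pmf_of_list_wf xs"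
  shows "map_pmf f (pmf_of_list xs) = pmf_of_list (map (map_prod f id) xs)"
proof (rule pmf_eqI)
  have "pmf_of_list_wf (map (map_prod f id) xs)"
    using assms by (auto simp: pmf_of_list_wf_def)
  then show "pmf (map_pmf f (pmf_of_list xs)) x = pmf (pmf_of_list (map (map_prod f id) xs)) x" for x
    by (simp add: pmf_map measure_pmf_of_list[OF assms] pmf_pmf_of_list filter_map o_def)
qed

text \<open>An atom may occur several times in \<open>xs\<close>, and its masses then add up.
  Exchanging the sum over atoms with the sum over the list counts every entry exactly once.\<close>

lemma expectation_pmf_of_list:
  fixes f :: "'a \<Rightarrow> real"
  assumes "pmf_of_list_wf xs"
  shows "measure_pmf.expectation (pmf_of_list xs) f = (\<Sum>(a, p)\<leftarrow>xs. f a * p)"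
proof -
  let ?A = "set (map fst xs)"
  have swap: "(\<Sum>a\<in>?A. \<Sum>z\<leftarrow>zs. h a z) = (\<Sum>z\<leftarrow>zs. \<Sum>a\<in>?A. h a z)"
    for zs and h :: "'a \<Rightarrow> 'a \<times> real \<Rightarrow> real"
    by (induction zs) (simp_all add: sum.distrib)
  have "measure_pmf.expectation (pmf_of_list xs) f = (\<Sum>a\<in>?A. f a * pmf (pmf_of_list xs) a)"
    using set_pmf_of_list[OF assms] by (intro integral_measure_pmf_real) auto
  also have "\<dots> = (\<Sum>a\<in>?A. \<Sum>z\<leftarrow>xs. if fst z = a then f (fst z) * snd z else 0)"
    unfolding pmf_pmf_of_list[OF assms]
    by (intro sum.cong refl)
       (auto simp: sum_list_const_mult[symmetric] sum_list_map_filter'[symmetric] o_def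
             intro!: arg_cong[where f = sum_list])
  also have "\<dots> = (\<Sum>z\<leftarrow>xs. \<Sum>a\<in>?A. if fst z = a then f (fst z) * snd z else 0)"
    by (rule swap)
  also have "\<dots> = (\<Sum>(a, p)\<leftarrow>xs. f a * p)"
    by (intro arg_cong[where f = sum_list] map_cong refl) (auto simp: case_prod_unfold)
  finally show ?thesis .
qed

section \<open>Indices, neighbours and arcs on the cycle\<close>

lemma cyc_wt_mod: "cyc_wt g w (j mod g) = cyc_wt g w j"
  by (simp add: cyc_wt_def cyc_edge_def mod_simps)

lemma cyc_wt_cong: "[i = j] (mod g) \<Longrightarrow> cyc_wt g w i = cyc_wt g w j"
  by (metis cong_def cyc_wt_mod)

lemma cyc_edge_in_cyc_E: "0 < g \<Longrightarrow> cyc_edge g j \<in> cyc_E g"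
  by (auto simp: cyc_E_def cyc_edge_def mod_simps intro!: image_eqI[of _ _ "j mod g"])

lemma cyc_wt_pos: "0 < g \<Longrightarrow> positive_weighting (cyc_E g) w \<Longrightarrow> 0 < cyc_wt g w j"
  by (simp add: cyc_wt_def positive_weighting_def cyc_edge_in_cyc_E)

lemma adj_cyc_iff:
  "adj (cyc_E g) x y \<longleftrightarrow> x < g \<and> y < g \<and> (y = (x + 1) mod g \<or> x = (y + 1) mod g)"
  by (auto simp: adj_def cyc_E_def cyc_edge_def image_iff doubleton_eq_iff)

lemma add_mod_eq_iff:
  fixes g :: nat
  assumes "a < g" "b < g"
  shows "(j + a) mod g = (j + b) mod g \<longleftrightarrow> a = b"
  using cong_add_lcancel_nat[of j a b g] assms by (simp add: cong_def)

text \<open>The predecessor of \<open>j\<close> is written \<open>j + (g - 1)\<close>, since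
  \<open>j - 1\<close> would be truncated at \<open>j = 0\<close>.\<close>

lemma cyc_neighbours:
  assumes "g \<ge> 3"
  shows "{y. adj (cyc_E g) (j mod g) y} = {(j + 1) mod g, (j + (g - 1)) mod g}"
proof (intro equalityI subsetI)
  fix y assume "y \<in> {y. adj (cyc_E g) (j mod g) y}"
  then consider "y = (j mod g + 1) mod g" | "y < g" "j mod g = (y + 1) mod g"
    by (auto simp: adj_cyc_iff)
  then show "y \<in> {(j + 1) mod g, (j + (g - 1)) mod g}"
  proof cases
    case 2
    have "(j + (g - 1)) mod g = (j mod g + (g - 1)) mod g"
      by (simp add: mod_simps)
    also have "\<dots> = (y + 1 + (g - 1)) mod g"
      unfolding 2(2) by (simp only: mod_simps)
    also have "\<dots> = y"
      using assms 2(1) by simp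
    finally show ?thesis by simp
  qed (simp add: mod_simps)
next
  fix y assume "y \<in> {(j + 1) mod g, (j + (g - 1)) mod g}"
  moreover have "((j + (g - 1)) mod g + 1) mod g = j mod g"
  proof -
    have "((j + (g - 1)) mod g + 1) mod g = (j + (g - 1) + 1) mod g"
      by (simp only: mod_simps)
    then show ?thesis using assms by simp
  qed
  ultimately show "y \<in> {y. adj (cyc_E g) (j mod g) y}"
    using assms by (auto simp: adj_cyc_iff mod_simps)
qed

text \<open>The parameter \<open>n\<close> counts vertices, so the arc has \<open>n - 1\<close>
  edges. Edges, avoiding arcs and the comparison paths for the geodesic condition are all of this
  form.\<close>

definition cyc_arc :: "nat \<Rightarrow> nat \<Rightarrow> nat \<Rightarrow> nat list" where
  "cyc_arc g a n = map (\<lambda>i. (a + i) mod g) [0..<n]"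

lemma is_path_cyc_arc:
  assumes "0 < n" "n \<le> g"
  shows "is_path (cyc_V g) (cyc_E g) (cyc_arc g a n)"
proof -
  have "distinct (cyc_arc g a n)"
    using assms by (auto simp: cyc_arc_def distinct_map inj_on_def add_mod_eq_iff)
  moreover have "successively (adj (cyc_E g)) (cyc_arc g a n)"
    using assms by (auto simp: cyc_arc_def successively_conv_nth adj_cyc_iff mod_simps)
  ultimately show ?thesis
    using assms by (auto simp: is_path_def cyc_arc_def cyc_V_def)
qed

lemma path_weight_cyc_arc: "path_weight w (cyc_arc g a n) = (\<Sum>i<n - 1. cyc_wt g w (a + i))"
  by (auto simp: path_weight_def cyc_arc_def cyc_wt_def cyc_edge_def intro!: sum.cong)

lemma hd_cyc_arc: "0 < n \<Longrightarrow> hd (cyc_arc g a n) = a mod g"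
  by (simp add: cyc_arc_def hd_map)

lemma last_cyc_arc: "0 < n \<Longrightarrow> last (cyc_arc g a n) = (a + (n - 1)) mod g"
  by (simp add: cyc_arc_def last_map)

lemma avoiding_arc_eq: "avoiding_arc g j = cyc_arc g (j + 2) (g - 2)"
  by (simp add: avoiding_arc_def cyc_arc_def)

lemma path_weight_avoiding_arc:
  "path_weight w (avoiding_arc g j) = (\<Sum>i<g - 3. cyc_wt g w (j + 2 + i))"
  by (simp add: avoiding_arc_eq path_weight_cyc_arc)

lemma hd_avoiding_arc: "g \<ge> 3 \<Longrightarrow> hd (avoiding_arc g j) = (j + 2) mod g"
  by (simp add: avoiding_arc_eq hd_cyc_arc)

lemma last_avoiding_arc: "g \<ge> 3 \<Longrightarrow> last (avoiding_arc g j) = (j + (g - 1)) mod g"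
  by (simp add: avoiding_arc_eq last_cyc_arc numeral_eq_Suc Suc_diff_Suc)

section \<open>The potential on the cycle and the geodesic condition\<close>

lemma edge_lipschitz_uminus: "edge_lipschitz E w f \<Longrightarrow> edge_lipschitz E w (\<lambda>v. - f v)"
  unfolding edge_lipschitz_def by (metis adj_commute insert_commute minus_diff_minus minus_diff_eq)

text \<open>Here \<open>F\<close> is indexed by the position on the cycle counted from \<open>j\<close>.\<close>

lemma edge_lipschitz_cyc:
  assumes "j < g" and F: "\<And>k. k < g \<Longrightarrow> \<bar>F k - F ((k + 1) mod g)\<bar> \<le> cyc_wt g w (j + k)"
  shows "edge_lipschitz (cyc_E g) w (\<lambda>v. F ((v + (g - j)) mod g))" (is "edge_lipschitz _ _ ?f")
proof -
  have step: "\<bar>?f x - ?f ((x + 1) mod g)\<bar> \<le> w {x, (x + 1) mod g}" if "x < g" for x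
  proof -
    \<comment> \<open>The position of \<open>x\<close> counted from \<open>j\<close>; adding
      \<open>g - j\<close> in place of subtracting \<open>j\<close> keeps the arithmetic in the
      naturals.\<close>
    define k where "k = (x + (g - j)) mod g"
    have "(j + k) mod g = (j + (x + (g - j))) mod g"
      by (simp add: k_def mod_simps)
    also have "\<dots> = x"
      using assms(1) that by simp
    finally have jk: "(j + k) mod g = x" .
    have "((x + 1) mod g + (g - j)) mod g = (k + 1) mod g"
      by (simp add: k_def mod_simps)
    moreover have "w {x, (x + 1) mod g} = cyc_wt g w (j + k)"
      using jk that by (metis cyc_wt_mod cyc_wt_def cyc_edge_def mod_less)
    moreover have "k < g"
      using that by (simp add: k_def)
    ultimately show ?thesis
      using F[of k] by (simp add: k_def)
  qed
  show ?thesis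
    unfolding edge_lipschitz_def adj_cyc_iff
    using step by (fastforce simp: insert_commute abs_le_iff)
qed

text \<open>The potential drops by \<open>w\<^sub>j\<close> along \<open>c\<^sub>j\<close> and by the length of the avoiding arc along that
  arc. Its offset \<open>t\<close> at \<open>j + 2\<close> must satisfy \<open>\<bar>t\<bar> \<le> w\<^bsub>j+1\<^esub>\<close> and
  \<open>\<bar>t + D - w\<^sub>j\<bar> \<le> w\<^bsub>j-1\<^esub>\<close>, and the two assumed inequalities say that these intervals meet.\<close>

lemma cyc_potential:
  fixes g j :: nat and w :: "nat set \<Rightarrow> real"
  defines "D \<equiv> path_weight w (avoiding_arc g j)"
  assumes g: "g \<ge> 3" and j: "j < g" and pos: "positive_weighting (cyc_E g) w"
    and "cyc_wt g w j \<le> D + cyc_wt g w (j + (g - 1)) + cyc_wt g w (j + 1)"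
    and "D \<le> cyc_wt g w j + cyc_wt g w (j + (g - 1)) + cyc_wt g w (j + 1)"
  obtains f where "edge_lipschitz (cyc_E g) w f"
    "f (j mod g) - f ((j + 1) mod g) = cyc_wt g w j"
    "f ((j + (g - 1)) mod g) - f ((j + 2) mod g) = D"
proof -
  \<comment> \<open>The larger of the two left endpoints, which lies in both intervals as soon as
    they meet.\<close>
  define t where "t = max (- cyc_wt g w (j + 1)) (cyc_wt g w j - D - cyc_wt g w (j + (g - 1)))"
  \<comment> \<open>From position \<open>2\<close> on, \<open>F\<close> rises by exactly the edge
    weights and reaches \<open>t + D\<close> at position \<open>g - 1\<close>. Only the two edges
    next to \<open>c_j\<close> remain to be checked: there the differences are \<open>t\<close> and
    \<open>t + D - w_j\<close>, up to sign.\<close>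
  define F where "F k = (if k = 0 then cyc_wt g w j else if k = 1 then 0
    else t + (\<Sum>i<k - 2. cyc_wt g w (j + 2 + i)))" for k
  define f where "f v = F ((v + (g - j)) mod g)" for v
  have wpos: "0 < cyc_wt g w k" for k
    using cyc_wt_pos[OF _ pos] g by simp
  have t: "\<bar>t\<bar> \<le> cyc_wt g w (j + 1)" "\<bar>t + D - cyc_wt g w j\<bar> \<le> cyc_wt g w (j + (g - 1))"
    using assms wpos[of "j + 1"] wpos[of "j + (g - 1)"] by (auto simp: t_def)
  have Flast: "F (g - 1) = t + D"
    using g by (simp add: F_def D_def path_weight_avoiding_arc numeral_eq_Suc)
  have "\<bar>F k - F ((k + 1) mod g)\<bar> \<le> cyc_wt g w (j + k)" if "k < g" for k
  proof -
    have "k = 0 \<or> k = 1 \<or> 2 \<le> k \<and> k < g - 1 \<or> k = g - 1"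
      using that by linarith
    then consider "k = 0" | "k = 1" | "2 \<le> k" "k < g - 1" | "k = g - 1"
      by blast
    then show ?thesis
    proof cases
      case 3
      then obtain m where m: "k = m + 2"
        by (metis le_iff_add add.commute)
      show ?thesis
        using 3 wpos[of "j + k"] by (simp add: F_def m add_ac)
    next
      case 4
      then show ?thesis
        using g t(2) Flast by (simp add: F_def)
    qed (use g t(1) wpos[of j] in \<open>auto simp: F_def numeral_eq_Suc\<close>)
  qed
  then have "edge_lipschitz (cyc_E g) w f"
    unfolding f_def by (rule edge_lipschitz_cyc[OF j])
  moreover have f: "f ((j + k) mod g) = F k" if "k < g" for k
  proof -
    have "((j + k) mod g + (g - j)) mod g = (k + (j + (g - j))) mod g"
      by (simp add: mod_simps add_ac)
    also have "\<dots> = k"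
      using j that by simp
    finally show ?thesis by (simp add: f_def)
  qed
  have "f (j mod g) = cyc_wt g w j" "f ((j + 1) mod g) = 0" "f ((j + 2) mod g) = t"
    "f ((j + (g - 1)) mod g) = t + D"
    using f[of 0] f[of 1] f[of 2] f[of "g - 1"] g Flast by (simp_all add: F_def)
  ultimately show ?thesis
    using that[of f] by simp
qed

text \<open>Necessity compares each of the two geodesics with the complementary way round the cycle.
  Sufficiency holds because one potential, up to sign, certifies both paths.\<close>

lemma geodesic_at_iff:
  assumes g: "g \<ge> 3" and j: "j < g" and pos: "positive_weighting (cyc_E g) w"
  shows "geodesic_at g w j \<longleftrightarrow>
    cyc_wt g w j \<le> path_weight w (avoiding_arc g j) + cyc_wt g w (j + (g - 1)) + cyc_wt g w (j + 1) \<and>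
    path_weight w (avoiding_arc g j) \<le> cyc_wt g w j + cyc_wt g w (j + (g - 1)) + cyc_wt g w (j + 1)"
    (is "_ \<longleftrightarrow> ?w \<le> ?D + ?a + ?b \<and> _")
proof -
  note cg = cyc_graph[OF g]
  have fin: "finite (cyc_V g)" by (simp add: cyc_V_def)
  have edge: "[j mod g, (j + 1) mod g] = cyc_arc g j 2"
    by (simp add: cyc_arc_def upt_rec)
  have we: "path_weight w (cyc_arc g j 2) = ?w"
    by (simp add: path_weight_cyc_arc)
  have ends: "hd (cyc_arc g j 2) = j mod g" "last (cyc_arc g j 2) = (j + 1) mod g"
    by (simp_all add: hd_cyc_arc last_cyc_arc)
  note aends = hd_avoiding_arc[OF g] last_avoiding_arc[OF g]
  show ?thesis
  proof
    assume "geodesic_at g w j"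
    then have geo: "gdist (cyc_V g) (cyc_E g) w (j mod g) ((j + 1) mod g) = ?w"
      "gdist (cyc_V g) (cyc_E g) w ((j + 2) mod g) ((j + (g - 1)) mod g) = ?D"
      unfolding geodesic_at_def is_geodesic_def edge we ends aends by simp_all
    \<comment> \<open>The competitor of \<open>c_j\<close> runs from \<open>j + 1\<close> the long
      way round to \<open>j\<close> through all \<open>g\<close> vertices.\<close>
    have "gdist (cyc_V g) (cyc_E g) w ((j + 1) mod g) ((j + 1 + (g - 1)) mod g)
        \<le> (\<Sum>i<g - 1. cyc_wt g w (j + 1 + i))"
      using gdist_le_path_weight[OF fin is_path_cyc_arc[of g g "j + 1"], of w] g
      by (simp add: path_weight_cyc_arc hd_cyc_arc last_cyc_arc)
    \<comment> \<open>The \<open>g - 1\<close> edges split into the first one, the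
      \<open>g - 3\<close> edges of the avoiding arc, and the last one.\<close>
    also have "{..<g - 1} = {..<Suc (Suc (g - 3))}"
      using g by auto
    also have "(\<Sum>i<Suc (Suc (g - 3)). cyc_wt g w (j + 1 + i)) = ?b + ?D + ?a"
    proof -
      have "Suc (Suc (j + g - Suc (Suc (Suc 0)))) = j + g - Suc 0"
        using g by simp
      then show ?thesis
        using g unfolding path_weight_avoiding_arc
        by (subst sum.lessThan_Suc_shift) (simp add: numeral_eq_Suc)
    qed
    finally have "?w \<le> ?D + ?a + ?b"
      using geo(1) g by (simp add: gdist_commute)
    moreover have "?D \<le> ?w + ?a + ?b"
    \<comment> \<open>For \<open>g = 3\<close> the vertices \<open>j - 1\<close> and
      \<open>j + 2\<close> coincide and the arc has length 0. Otherwise the competitor is the path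
      through \<open>j - 1\<close>, \<open>j\<close>, \<open>j + 1\<close>, \<open>j + 2\<close>,
      which are four distinct vertices.\<close>
    proof (cases "g = 3")
      case True
      then show ?thesis
        using cyc_wt_pos[OF _ pos, of j] cyc_wt_pos[OF _ pos, of "j + 1"] cyc_wt_pos[OF _ pos, of "j + (g - 1)"]
        by (simp add: path_weight_avoiding_arc)
    next
      case False
      have "gdist (cyc_V g) (cyc_E g) w ((j + (g - 1)) mod g) ((j + (g - 1) + 3) mod g)
          \<le> (\<Sum>i<3. cyc_wt g w (j + (g - 1) + i))"
        using gdist_le_path_weight[OF fin is_path_cyc_arc[of 4 g "j + (g - 1)"], of w] g False
        by (simp add: path_weight_cyc_arc hd_cyc_arc last_cyc_arc)
      also have "\<dots> = ?a + cyc_wt g w (j + (g - 1) + 1) + cyc_wt g w (j + (g - 1) + 2)"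
        by (simp add: numeral_eq_Suc)
      also have "cyc_wt g w (j + (g - 1) + 1) = ?w"
      proof -
        have "j + (g - 1) + 1 = j + g" using g by simp
        then show ?thesis by (intro cyc_wt_cong) (simp add: cong_def)
      qed
      also have "cyc_wt g w (j + (g - 1) + 2) = ?b"
      proof -
        have "j + (g - 1) + 2 = j + 1 + g" using g by simp
        then show ?thesis by (metis cyc_wt_mod mod_add_self2)
      qed
      also have "(j + (g - 1) + 3) mod g = (j + 2) mod g"
      proof -
        have "j + (g - 1) + 3 = j + 2 + g" using g by simp
        then show ?thesis by (metis mod_add_self2)
      qed
      finally show ?thesis
        using geo(2) by (simp add: gdist_commute)
    qed
    ultimately show "?w \<le> ?D + ?a + ?b \<and> ?D \<le> ?w + ?a + ?b" ..
  next
    assume "?w \<le> ?D + ?a + ?b \<and> ?D \<le> ?w + ?a + ?b"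
    then obtain f where f: "edge_lipschitz (cyc_E g) w f" "f (j mod g) - f ((j + 1) mod g) = ?w"
      "f ((j + (g - 1)) mod g) - f ((j + 2) mod g) = ?D"
      using cyc_potential[OF g j pos] by blast
    have "is_geodesic (cyc_V g) (cyc_E g) w (cyc_arc g j 2)"
      using g f by (intro is_geodesic_edge_lipschitzI[OF cg _ f(1)] is_path_cyc_arc) (simp_all add: we ends)
    \<comment> \<open>The arc is listed from \<open>j + 2\<close> to \<open>j - 1\<close>, whereas
      \<open>f\<close> drops from \<open>j - 1\<close> to \<open>j + 2\<close>; hence the
      certificate is \<open>-f\<close>.\<close>
    moreover have "is_geodesic (cyc_V g) (cyc_E g) w (avoiding_arc g j)"
      using g f by (intro is_geodesic_edge_lipschitzI[OF cg _ edge_lipschitz_uminus[OF f(1)]])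
        (simp_all add: aends, simp add: avoiding_arc_eq is_path_cyc_arc)
    ultimately show "geodesic_at g w j"
      by (simp only: geodesic_at_def edge)
  qed
qed

section \<open>Lazy walks on the cycle and their optimal transport\<close>

lemma lazy_walk_cyc:
  assumes g: "g \<ge> 3" and \<alpha>: "0 \<le> \<alpha>" "\<alpha> \<le> 1"
  shows "lazy_walk (cyc_E g) \<alpha> (j mod g) =
    pmf_of_list [(j mod g, \<alpha>), ((j + 1) mod g, (1 - \<alpha>) / 2), ((j + (g - 1)) mod g, (1 - \<alpha>) / 2)]"
    (is "_ = pmf_of_list ?xs")
proof (rule pmf_eqI)
  fix v
  define x y z where "x = j mod g" and "y = (j + 1) mod g" and "z = (j + (g - 1)) mod g"
  have N: "{y. adj (cyc_E g) x y} = {y, z}"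
    unfolding x_def y_def z_def by (rule cyc_neighbours[OF g])
  have d: "x \<noteq> y" "x \<noteq> z" "y \<noteq> z"
    using add_mod_eq_iff[of 0 g 1 j] add_mod_eq_iff[of 0 g "g - 1" j] add_mod_eq_iff[of 1 g "g - 1" j] g
    unfolding x_def y_def z_def by simp_all
  have mem: "adj (cyc_E g) x v \<longleftrightarrow> v = y \<or> v = z" for v
    using N by blast
  have deg: "deg (cyc_E g) x = 2"
    unfolding deg_def N using d by simp
  have wf: "pmf_of_list_wf [(x, \<alpha>), (y, (1 - \<alpha>) / 2), (z, (1 - \<alpha>) / 2)]"
    using \<alpha> by (auto simp: pmf_of_list_wf_def)
  have "pmf (lazy_walk (cyc_E g) \<alpha> x) v = (if v = x then \<alpha> else if v = y \<or> v = z then (1 - \<alpha>) / 2 else 0)"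
    using pmf_lazy_walk[of "cyc_E g" x \<alpha> v, unfolded N] d \<alpha> by (simp add: mem deg)
  also have "\<dots> = pmf (pmf_of_list [(x, \<alpha>), (y, (1 - \<alpha>) / 2), (z, (1 - \<alpha>) / 2)]) v"
    unfolding pmf_pmf_of_list[OF wf] using d by simp
  finally show "pmf (lazy_walk (cyc_E g) \<alpha> (j mod g)) v = pmf (pmf_of_list ?xs) v"
    unfolding x_def y_def z_def .
qed

text \<open>Only the total mass per atom is compared. Marginals of a coupling can thus be matched
  even when listed vertices coincide, as \<open>j - 1\<close> and \<open>j + 2\<close> do for
  \<open>g = 3\<close>.\<close>

lemma pmf_of_list_eqI:
  assumes "pmf_of_list_wf xs" "pmf_of_list_wf ys"
    "\<And>v. sum_list (map snd (filter (\<lambda>z. fst z = v) xs)) = sum_list (map snd (filter (\<lambda>z. fst z = v) ys))"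
  shows "pmf_of_list xs = pmf_of_list ys"
  using assms by (intro pmf_eqI) (simp add: pmf_pmf_of_list)

lemma cyc_dist_avoiding_arc:
  assumes "g \<ge> 3" "geodesic_at g w j"
  shows "cyc_dist g w (j + g - 1) (j + 2) = path_weight w (avoiding_arc g j)"
  using assms hd_avoiding_arc[of g j] last_avoiding_arc[of g j]
    gdist_commute[of "cyc_V g" "cyc_E g" w "(j + 2) mod g" "(j + (g - 1)) mod g"]
  by (simp add: geodesic_at_def is_geodesic_def cyc_dist_def)

lemma wasserstein_cyc:
  assumes g: "g \<ge> 3" and j: "j < g" and pos: "positive_weighting (cyc_E g) w"
    and geo: "geodesic_at g w j" and \<alpha>: "1/3 \<le> \<alpha>" "\<alpha> \<le> 1"
  shows "wasserstein (gdist (cyc_V g) (cyc_E g) w)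
      (lazy_walk (cyc_E g) \<alpha> (j mod g)) (lazy_walk (cyc_E g) \<alpha> ((j + 1) mod g)) =
    (3 * \<alpha> - 1) / 2 * cyc_wt g w j + (1 - \<alpha>) / 2 * path_weight w (avoiding_arc g j)"
proof -
  let ?d = "gdist (cyc_V g) (cyc_E g) w"
  let ?x = "j mod g" and ?y = "(j + 1) mod g" and ?z = "(j + (g - 1)) mod g" and ?u = "(j + 2) mod g"
  let ?\<mu> = "lazy_walk (cyc_E g) \<alpha> ?x" and ?\<nu> = "lazy_walk (cyc_E g) \<alpha> ?y"
  define \<beta> where "\<beta> = (1 - \<alpha>) / 2"
  \<comment> \<open>The transport plan: mass \<open>\<beta>\<close> stays at each end of
    \<open>c_j\<close>, the excess \<open>\<alpha> - \<beta>\<close> moves along \<open>c_j\<close>,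
    and \<open>\<beta>\<close> moves along the avoiding arc. The excess is nonnegative exactly when
    \<open>\<alpha> \<ge> 1/3\<close>.\<close>
  define xs where "xs = [((?x, ?x), \<beta>), ((?y, ?y), \<beta>), ((?x, ?y), \<alpha> - \<beta>), ((?z, ?u), \<beta>)]"
  obtain f where f: "edge_lipschitz (cyc_E g) w f" "f ?x - f ?y = cyc_wt g w j"
      "f ?z - f ?u = path_weight w (avoiding_arc g j)"
    using cyc_potential[OF g j pos] geo unfolding geodesic_at_iff[OF g j pos] by blast
  have \<mu>: "?\<mu> = pmf_of_list [(?x, \<alpha>), (?y, \<beta>), (?z, \<beta>)]"
    using lazy_walk_cyc[OF g, of \<alpha> j] \<alpha> by (simp add: \<beta>_def)
  \<comment> \<open>The predecessor of \<open>j + 1\<close> appears as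
    \<open>j + 1 + (g - 1)\<close>, which reduces to \<open>j\<close> modulo
    \<open>g\<close>.\<close>
  have \<nu>: "?\<nu> = pmf_of_list [(?y, \<alpha>), (?u, \<beta>), (?x, \<beta>)]"
    using lazy_walk_cyc[OF g, of \<alpha> "j + 1"] \<alpha> g by (simp add: \<beta>_def)
  have \<beta>: "0 \<le> \<beta>" "\<beta> \<le> \<alpha>" "\<alpha> + \<beta> + \<beta> = 1"
    using \<alpha> by (simp_all add: \<beta>_def field_simps)
  have wf3: "pmf_of_list_wf [(a, \<alpha>), (b, \<beta>), (c, \<beta>)]" for a b c :: nat
    using \<beta> by (simp add: pmf_of_list_wf_def)
  have wf4: "pmf_of_list_wf [(a, \<beta>), (b, \<beta>), (c, \<alpha> - \<beta>), (d, \<beta>)]" for a b c d :: 'b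
    using \<beta> by (simp add: pmf_of_list_wf_def)
  have marg: "map_pmf fst (pmf_of_list xs) = ?\<mu>" "map_pmf snd (pmf_of_list xs) = ?\<nu>"
    unfolding xs_def \<mu> \<nu> map_pmf_of_list[OF wf4]
    by (auto intro!: pmf_of_list_eqI wf3 wf4)
  have "wasserstein ?d ?\<mu> ?\<nu> = measure_pmf.expectation ?\<mu> f - measure_pmf.expectation ?\<nu> f"
  proof (rule wasserstein_eq_dual[OF _ _ _ marg])
    show "finite (set_pmf ?\<mu>)" "finite (set_pmf ?\<nu>)"
      unfolding \<mu> \<nu> by (simp_all add: finite_set_pmf_of_list wf3)
    have "set_pmf ?\<mu> \<subseteq> cyc_V g" "set_pmf ?\<nu> \<subseteq> cyc_V g"
      unfolding \<mu> \<nu> using g by (force dest: subsetD[OF set_pmf_of_list[OF wf3]] simp: cyc_V_def)+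
    then show "f a - f b \<le> ?d a b" if "a \<in> set_pmf ?\<mu>" "b \<in> set_pmf ?\<nu>" for a b
      using edge_lipschitz_gdist[OF cyc_graph[OF g] f(1)] that by blast
    have "?d ?x ?y = cyc_wt g w j"
      using geo by (simp add: geodesic_at_def is_geodesic_def path_weight_def cyc_wt_def cyc_edge_def)
    moreover have "?d ?z ?u = path_weight w (avoiding_arc g j)"
      using cyc_dist_avoiding_arc[OF g geo] g by (simp add: cyc_dist_def)
    moreover have "?d ?x ?x = 0" "?d ?y ?y = 0"
      using g by (intro gdist_self[OF cyc_graph[OF g] pos]; simp add: cyc_V_def)+
    ultimately show "?d a b = f a - f b" if "(a, b) \<in> set_pmf (pmf_of_list xs)" for a b
      using subsetD[OF set_pmf_of_list[OF wf4] that[unfolded xs_def]] f by auto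
  qed
  also have "measure_pmf.expectation ?\<mu> f = f ?x * \<alpha> + f ?y * \<beta> + f ?z * \<beta>"
    unfolding \<mu> expectation_pmf_of_list[OF wf3] by simp
  also have "measure_pmf.expectation ?\<nu> f = f ?y * \<alpha> + f ?u * \<beta> + f ?x * \<beta>"
    unfolding \<nu> expectation_pmf_of_list[OF wf3] by simp
  also have "f ?x * \<alpha> + f ?y * \<beta> + f ?z * \<beta> - (f ?y * \<alpha> + f ?u * \<beta> + f ?x * \<beta>)
      = (\<alpha> - \<beta>) * (f ?x - f ?y) + \<beta> * (f ?z - f ?u)"
    by (simp add: algebra_simps)
  also have "\<alpha> - \<beta> = (3 * \<alpha> - 1) / 2"
    by (simp add: \<beta>_def field_simps)
  finally show ?thesis
    unfolding f \<beta>_def .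
qed

section \<open>The curvature of an edge\<close>

lemma kappa_alpha_cyc:
  assumes "g \<ge> 3" "j < g" and pos: "positive_weighting (cyc_E g) w"
    and geo: "geodesic_at g w j" and "1/3 \<le> \<alpha>" "\<alpha> < 1"
  shows "kappa_alpha (cyc_V g) (cyc_E g) w \<alpha> (j mod g) ((j + 1) mod g) / (1 - \<alpha>) =
    1/2 * (3 - path_weight w (avoiding_arc g j) / cyc_wt g w j)"
proof -
  have "0 < cyc_wt g w j"
    using cyc_wt_pos[OF _ pos] assms(1) by simp
  moreover have "gdist (cyc_V g) (cyc_E g) w (j mod g) ((j + 1) mod g) = cyc_wt g w j"
    using geo by (simp add: geodesic_at_def is_geodesic_def path_weight_def cyc_wt_def cyc_edge_def)
  moreover have "1 - \<alpha> \<noteq> 0"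
    using assms by simp
  \<comment> \<open>Since \<open>1 - (3 * \<alpha> - 1) / 2 = 3 * (1 - \<alpha>) / 2\<close>, the
    factor \<open>1 - \<alpha>\<close> cancels throughout.\<close>
  ultimately show ?thesis
    using wasserstein_cyc[of g j w \<alpha>] assms unfolding kappa_alpha_def by (simp only:) (simp add: field_simps)
qed

lemma tendsto_cyc_curv:
  assumes "g \<ge> 3" "j < g" "positive_weighting (cyc_E g) w" "geodesic_at g w j"
  shows "((\<lambda>\<alpha>. kappa_alpha (cyc_V g) (cyc_E g) w \<alpha> (j mod g) ((j + 1) mod g) / (1 - \<alpha>))
    \<longlongrightarrow> 1/2 * (3 - path_weight w (avoiding_arc g j) / cyc_wt g w j)) (at 1 within {0..1})"
proof (rule tendsto_eventually)
  have "eventually (\<lambda>\<alpha>. \<alpha> \<in> {1/3<..}) (at (1::real) within {0..1})"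
    by (intro topological_tendstoD[OF tendsto_ident_at]) auto
  moreover have "eventually (\<lambda>\<alpha>. \<alpha> \<in> {0..1} \<and> \<alpha> \<noteq> 1) (at (1::real) within {0..1})"
    by (simp add: eventually_at_filter)
  ultimately show "eventually (\<lambda>\<alpha>. kappa_alpha (cyc_V g) (cyc_E g) w \<alpha> (j mod g) ((j + 1) mod g) / (1 - \<alpha>)
      = 1/2 * (3 - path_weight w (avoiding_arc g j) / cyc_wt g w j)) (at 1 within {0..1})"
    by eventually_elim (intro kappa_alpha_cyc assms; auto)
qed

lemma cyc_curv_eq:
  assumes "g \<ge> 3" "j < g" "positive_weighting (cyc_E g) w" "geodesic_at g w j"
  shows "cyc_curv g w j = 1/2 * (3 - path_weight w (avoiding_arc g j) / cyc_wt g w j)"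
  unfolding cyc_curv_def LLY_curvature_def
  \<comment> \<open>\<open>Lim\<close> picks out the limit because 1 is not isolated in
    \<open>{0..1}\<close>: the filter is the nontrivial left filter at 1.\<close>
  using tendsto_cyc_curv[OF assms] by (intro tendsto_Lim) (auto simp: at_within_Icc_at_left)

lemma cyc_curv_mult_wt:
  assumes "g \<ge> 3" "j < g" "positive_weighting (cyc_E g) w" "geodesic_at g w j"
  shows "cyc_curv g w j * cyc_wt g w j = 1/2 * (3 * cyc_wt g w j - path_weight w (avoiding_arc g j))"
  using cyc_wt_pos[OF _ assms(3), of j] assms(1) by (simp add: cyc_curv_eq[OF assms] field_simps)

text \<open>The radius comes from the tightest case, two edges against three for
  \<open>g = 5\<close>: \<open>2 * (c + \<epsilon>) \<le> 3 * (c - \<epsilon>)\<close> means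
  \<open>\<epsilon> \<le> c / 5\<close>.\<close>

lemma geodesic_at_near_uniform:
  assumes g: "g \<in> {3, 4, 5}" and "j < g" and pos: "positive_weighting (cyc_E g) w" and "c > 0"
    and close: "\<And>e. e \<in> cyc_E g \<Longrightarrow> \<bar>w e - c\<bar> < c / 5"
  shows "geodesic_at g w j"
proof -
  have near: "\<bar>cyc_wt g w k - c\<bar> < c / 5" for k
    using g close[OF cyc_edge_in_cyc_E[of g k]] by (auto simp: cyc_wt_def)
  \<comment> \<open>The avoiding arc has at most two edges, so one bound serves all three values of
    \<open>g\<close>.\<close>
  have D: "path_weight w (avoiding_arc g j) \<le> cyc_wt g w (j + 2) + cyc_wt g w (j + 3)"
    "0 \<le> path_weight w (avoiding_arc g j)"
    using g cyc_wt_pos[OF _ pos, of "j + 2"] cyc_wt_pos[OF _ pos, of "j + 3"]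
    by (auto simp: path_weight_avoiding_arc numeral_eq_Suc intro: less_imp_le)
  have "g \<ge> 3" using g by auto
  then show ?thesis
    unfolding geodesic_at_iff[OF \<open>g \<ge> 3\<close> assms(2,3)]
    using D near[of j] near[of "j + 1"] near[of "j + (g - 1)"] near[of "j + 2"] near[of "j + 3"]
    by (simp only: abs_less_iff) linarith
qed

section \<open>The matrix form of the curvature\<close>

lemma cyc_R_carrier: "g \<in> {3, 4, 5} \<Longrightarrow> cyc_R g \<in> carrier_mat g g"
  by (auto simp: cyc_R_def P_opp_def P_2_def)

text \<open>Replaces \<open>j - 2\<close>, which may be negative, by the natural number
  \<open>j + 3\<close> of the same residue.\<close>

lemma P_2_cong_iff:
  "[int k = int j + 2] (mod 5) \<or> [int k = int j - 2] (mod 5) \<longleftrightarrow> [k = j + 2] (mod 5) \<or> [k = j + 3] (mod 5)"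
proof -
  have "[int j - 2 = int j + 3] (mod 5)"
    by (simp add: cong_iff_dvd_diff)
  then have "[int k = int j - 2] (mod 5) \<longleftrightarrow> [int k = int j + 3] (mod 5)"
    by (simp add: cong_def)
  then show ?thesis
    using cong_int_iff[of k "j + 2" 5] cong_int_iff[of k "j + 3" 5]
    unfolding of_nat_add of_nat_numeral by blast
qed

text \<open>Negation fixes the shift 2 modulo 4 and swaps the shifts 2 and 3 modulo 5; both facts
  are checked by enumerating residues.\<close>

lemma cyc_R_symmetric:
  assumes "g \<in> {3, 4, 5}"
  shows "transpose_mat (cyc_R g) = cyc_R g"
proof (rule eq_matI)
  fix i j assume "i < dim_row (cyc_R g)" "j < dim_col (cyc_R g)"
  moreover have "[i = j + 2] (mod 4) \<longleftrightarrow> [j = i + 2] (mod 4)" if "i < 4" "j < 4"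
  proof -
    have "i \<in> {0, 1, 2, 3}" "j \<in> {0, 1, 2, 3}" using that by auto
    then show ?thesis by (auto simp: cong_def)
  qed
  moreover have "[i = j + 2] (mod 5) \<or> [i = j + 3] (mod 5) \<longleftrightarrow> [j = i + 2] (mod 5) \<or> [j = i + 3] (mod 5)"
    if "i < 5" "j < 5"
  proof -
    have "i \<in> {0, 1, 2, 3, 4}" "j \<in> {0, 1, 2, 3, 4}" using that by auto
    then show ?thesis by (auto simp: cong_def)
  qed
  ultimately show "transpose_mat (cyc_R g) $$ (i, j) = cyc_R g $$ (i, j)"
    using assms by (auto simp: cyc_R_def P_opp_def P_2_def P_2_cong_iff)
qed (use carrier_matD[OF cyc_R_carrier[OF assms]] in simp_all)

lemma row_cyc_R_weight_vec:
  assumes g: "g \<in> {3, 4, 5}" and j: "j < g"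
  shows "row (cyc_R g) j \<bullet> weight_vec g w =
    - (1/2 * (3 * cyc_wt g w j - path_weight w (avoiding_arc g j)))"
proof -
  have row: "row (cyc_R g) j \<bullet> weight_vec g w = (\<Sum>k<g. cyc_R g $$ (j, k) * cyc_wt g w k)"
    using j cyc_R_carrier[OF g] by (simp add: scalar_prod_def weight_vec_def lessThan_atLeast0)
  \<comment> \<open>The indicator sits at \<open>i mod g\<close>, so shifted indices that wrap
    around are absorbed by periodicity of the weights.\<close>
  have delta: "(\<Sum>k<g. (if k = i mod g then 1 else 0) * cyc_wt g w k) = cyc_wt g w i" for i
    using j by (simp add: if_distrib[of "\<lambda>x. x * _"] cyc_wt_mod cong: if_cong)
  have delta_j: "(\<Sum>k<g. (if k = j then 1 else 0) * cyc_wt g w k) = cyc_wt g w j"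
    using delta[of j] j by simp
  consider "g = 3" | "g = 4" | "g = 5"
    using g by blast
  then show ?thesis
  proof cases
    case 1
    have "cyc_R g $$ (j, k) * cyc_wt g w k = (- 3/2) * ((if k = j then 1 else 0) * cyc_wt g w k)" if "k < g" for k
      using that 1 j by (simp add: cyc_R_def)
    then have "row (cyc_R g) j \<bullet> weight_vec g w = (- 3/2) * cyc_wt g w j"
      unfolding row delta_j[symmetric] sum_distrib_left by (intro sum.cong) simp_all
    then show ?thesis
      using 1 by (simp add: path_weight_avoiding_arc)
  next
    case 2
    have "cyc_R g $$ (j, k) * cyc_wt g w k = (- 3/2) * ((if k = j then 1 else 0) * cyc_wt g w k)
        + 1/2 * ((if k = (j + 2) mod g then 1 else 0) * cyc_wt g w k)" if "k < g" for k
      using that 2 j by (simp add: cyc_R_def P_opp_def cong_def)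
    then have "row (cyc_R g) j \<bullet> weight_vec g w = (- 3/2) * cyc_wt g w j + 1/2 * cyc_wt g w (j + 2)"
      unfolding row delta_j[symmetric] delta[of "j + 2", symmetric] sum_distrib_left sum.distrib[symmetric]
      by (intro sum.cong) simp_all
    then show ?thesis
      using 2 by (simp add: path_weight_avoiding_arc field_simps)
  next
    case 3
    \<comment> \<open>Distinctness of the two positions turns the disjunction in \<open>P_2\<close>
      into a sum of two indicators.\<close>
    have "(j + 2) mod g \<noteq> (j + 3) mod g"
      using add_mod_eq_iff[of 2 g 3 j] 3 by simp
    then have "cyc_R g $$ (j, k) * cyc_wt g w k = (- 3/2) * ((if k = j then 1 else 0) * cyc_wt g w k)
        + (1/2 * ((if k = (j + 2) mod g then 1 else 0) * cyc_wt g w k)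
         + 1/2 * ((if k = (j + 3) mod g then 1 else 0) * cyc_wt g w k))" if "k < g" for k
      using that 3 j unfolding cyc_R_def P_2_def by (simp add: P_2_cong_iff) (auto simp: cong_def)
    then have "row (cyc_R g) j \<bullet> weight_vec g w
        = (- 3/2) * cyc_wt g w j + (1/2 * cyc_wt g w (j + 2) + 1/2 * cyc_wt g w (j + 3))"
      unfolding row delta_j[symmetric] delta[of "j + 2", symmetric] delta[of "j + 3", symmetric]
        sum_distrib_left sum.distrib[symmetric]
      by (intro sum.cong) simp_all
    then show ?thesis
      using 3 by (simp add: path_weight_avoiding_arc numeral_eq_Suc field_simps)
  qed
qed

section \<open>The Einstein property of uniform weightings\<close>

lemma uniform_discrete_Einstein:
  assumes g: "g \<in> {3, 4, 5}" and c: "c > 0"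
  shows "discrete_Einstein_metric (cyc_V g) (cyc_E g) (\<lambda>_. c)
    (if g = 3 then 3/2 else if g = 4 then 1 else 1/2)" (is "discrete_Einstein_metric _ _ _ ?\<kappa>")
proof -
  have pos: "positive_weighting (cyc_E g) (\<lambda>_. c)"
    using c by (simp add: positive_weighting_def)
  have curv: "LLY_curvature (cyc_V g) (cyc_E g) (\<lambda>_. c) (j mod g) ((j + 1) mod g) = ?\<kappa>" if "j < g" for j
  proof -
    have "geodesic_at g (\<lambda>_. c) j"
      using c by (intro geodesic_at_near_uniform[OF g that pos c]) simp
    then show ?thesis
      using cyc_curv_eq[of g j "\<lambda>_. c"] g c that pos
      by (auto simp: cyc_curv_def path_weight_avoiding_arc cyc_wt_def)
  qed
  have "LLY_curvature (cyc_V g) (cyc_E g) (\<lambda>_. c) x y = ?\<kappa>" if "{x, y} \<in> cyc_E g" for x y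
  proof -
    have "adj (cyc_E g) x y"
      using that by (simp add: adj_def)
    then show ?thesis
      \<comment> \<open>Either endpoint may be the one followed by the other on the cycle; symmetry
        of the curvature covers the second case.\<close>
      using curv[of x] curv[of y] LLY_curvature_commute[of "cyc_V g" "cyc_E g" "\<lambda>_. c" x y]
      unfolding adj_cyc_iff by auto
  qed
  with pos show ?thesis
    unfolding discrete_Einstein_metric_def by blast
qed

theorem proposition6p1:
  fixes g :: nat
  assumes "g \<in> {3, 4, 5}"
  shows
    "(\<forall>w j. positive_weighting (cyc_E g) w \<and> j < g \<and> geodesic_at g w j \<longrightarrow>
        cyc_dist g w (j + g - 1) (j + 2) = path_weight w (avoiding_arc g j) \<and>
        ((\<lambda>\<alpha>. kappa_alpha (cyc_V g) (cyc_E g) w \<alpha> (j mod g) ((j + 1) mod g) / (1 - \<alpha>))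
           \<longlongrightarrow> cyc_curv g w j) (at 1 within {0..1}) \<and>
        cyc_curv g w j = 1/2 * (3 - cyc_dist g w (j + g - 1) (j + 2) / cyc_wt g w j) \<and>
        (g = 3 \<longrightarrow> cyc_curv g w j = 3/2) \<and>
        (g = 4 \<longrightarrow> cyc_curv g w j = 1/2 * (3 - cyc_wt g w (j + 2) / cyc_wt g w j)) \<and>
        (g = 5 \<longrightarrow> cyc_curv g w j =
           1/2 * (3 - (cyc_wt g w (j + 2) + cyc_wt g w (j + 3)) / cyc_wt g w j)) \<and>
        cyc_curv g w j * cyc_wt g w j =
          1/2 * (3 * cyc_wt g w j - cyc_dist g w (j + g - 1) (j + 2))) \<and>
     (\<forall>j<g. \<exists>a\<in>carrier_vec g. \<forall>w. positive_weighting (cyc_E g) w \<and> geodesic_at g w j \<longrightarrow>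
        cyc_curv g w j * cyc_wt g w j = scalar_prod a (weight_vec g w)) \<and>
     (\<forall>c>0. \<exists>\<epsilon>>0. \<forall>w. positive_weighting (cyc_E g) w \<and> (\<forall>e\<in>cyc_E g. \<bar>w e - c\<bar> < \<epsilon>) \<longrightarrow>
        (\<forall>j<g. geodesic_at g w j)) \<and>
     transpose_mat (cyc_R g) = cyc_R g \<and>
     (\<forall>w. positive_weighting (cyc_E g) w \<and> (\<forall>j<g. geodesic_at g w j) \<longrightarrow>
        (\<forall>j<g. cyc_curv g w j * cyc_wt g w j =
           - vec_index (mult_mat_vec (cyc_R g) (weight_vec g w)) j)) \<and>
     (\<forall>c>0. discrete_Einstein_metric (cyc_V g) (cyc_E g) (\<lambda>_. c)
        (if g = 3 then 3/2 else if g = 4 then 1 else 1/2))"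
proof -
  have g3: "g \<ge> 3" using assms by auto
  have part1: "cyc_dist g w (j + g - 1) (j + 2) = path_weight w (avoiding_arc g j) \<and>
        ((\<lambda>\<alpha>. kappa_alpha (cyc_V g) (cyc_E g) w \<alpha> (j mod g) ((j + 1) mod g) / (1 - \<alpha>))
           \<longlongrightarrow> cyc_curv g w j) (at 1 within {0..1}) \<and>
        cyc_curv g w j = 1/2 * (3 - cyc_dist g w (j + g - 1) (j + 2) / cyc_wt g w j) \<and>
        (g = 3 \<longrightarrow> cyc_curv g w j = 3/2) \<and>
        (g = 4 \<longrightarrow> cyc_curv g w j = 1/2 * (3 - cyc_wt g w (j + 2) / cyc_wt g w j)) \<and>
        (g = 5 \<longrightarrow> cyc_curv g w j =
           1/2 * (3 - (cyc_wt g w (j + 2) + cyc_wt g w (j + 3)) / cyc_wt g w j)) \<and>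
        cyc_curv g w j * cyc_wt g w j =
          1/2 * (3 * cyc_wt g w j - cyc_dist g w (j + g - 1) (j + 2))"
    if "positive_weighting (cyc_E g) w" "j < g" "geodesic_at g w j" for w j
  proof -
    note h = g3 that(2,1,3)
    have "path_weight w (avoiding_arc 5 j) = cyc_wt 5 w (j + 2) + cyc_wt 5 w (j + 3)"
      by (simp add: path_weight_avoiding_arc numeral_eq_Suc)
    then show ?thesis
      unfolding cyc_dist_avoiding_arc[OF g3 that(3)] cyc_curv_mult_wt[OF h]
      using tendsto_cyc_curv[OF h] unfolding cyc_curv_eq[OF h]
      by (auto simp: path_weight_avoiding_arc)
  qed
  have part5: "cyc_curv g w j * cyc_wt g w j = - vec_index (mult_mat_vec (cyc_R g) (weight_vec g w)) j"
    if "positive_weighting (cyc_E g) w" "j < g" "geodesic_at g w j" for w j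
    using cyc_curv_mult_wt[OF g3 that(2,1,3)] row_cyc_R_weight_vec[OF assms that(2)]
      cyc_R_carrier[OF assms] that(2) by simp
  \<comment> \<open>The linear functional is minus row \<open>j\<close> of the matrix, which does
    not depend on \<open>w\<close>; only the geodesic condition at this one \<open>j\<close>
    enters.\<close>
  have part2: "\<exists>a\<in>carrier_vec g. \<forall>w. positive_weighting (cyc_E g) w \<and> geodesic_at g w j \<longrightarrow>
        cyc_curv g w j * cyc_wt g w j = scalar_prod a (weight_vec g w)" if "j < g" for j
  proof (rule bexI[of _ "- row (cyc_R g) j"])
    show "- row (cyc_R g) j \<in> carrier_vec g"
      using cyc_R_carrier[OF assms] that by simp
    show "\<forall>w. positive_weighting (cyc_E g) w \<and> geodesic_at g w j \<longrightarrow>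
        cyc_curv g w j * cyc_wt g w j = scalar_prod (- row (cyc_R g) j) (weight_vec g w)"
      using part5 that cyc_R_carrier[OF assms] by (auto simp: weight_vec_def)
  qed
  have part3: "\<exists>\<epsilon>>0. \<forall>w. positive_weighting (cyc_E g) w \<and> (\<forall>e\<in>cyc_E g. \<bar>w e - c\<bar> < \<epsilon>) \<longrightarrow>
        (\<forall>j<g. geodesic_at g w j)" if "c > 0" for c :: real
    using geodesic_at_near_uniform[OF assms] that by (intro exI[of _ "c / 5"]) auto
  show ?thesis
    apply (intro conjI)
    subgoal using part1 by blast
    subgoal using part2 by blast
    subgoal using part3 by blast
    subgoal by (rule cyc_R_symmetric[OF assms])
    subgoal using part5 by blast
    subgoal using uniform_discrete_Einstein[OF assms] by blast
    done
qed

end
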